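(* Consider a single-integrator multi-agent system consisting of $m$ agents with dynamics $\dot p_i=u_i$, $p_i,u_i\in\mathbb R^2$, and measurements $y_i=C_{ii}p_i+\sum_{j\in\mathcal N_i(\mathrm G_{\rm o})}C_{ij}p_j$, $i\in\mathcal V=\{1,\dots,m\}$. For all $i\in\mathcal V$, the pair $(A_{ii},C_{ii})$ (where $A_{ii}=0_{2\times2}$) is observable if and only if node $i$ is not a source in the graph $\mathrm G_{\rm o}^+$, i.e., agent $i$ has at least one relative measurement or absolute measurement.
   Context: The sensing graph $\mathrm G_{\rm o}=(\mathcal V,\mathcal E_{\rm o})$ is a directed graph without self-loops; $(j,i)\in\mathcal E_{\rm o}$ means agent $i$ measures the relative position $p_{ij}=p_j-p_i$; $\mathcal N_i(\mathrm G_{\rm o})=\{j\ne i:(j,i)\in\mathcal E_{\rm o}\}$. With $O$ the origin of the global reference frame, $\mathcal E_{\rm a}\subseteq\{O\}\times\mathcal V$ is the set of absolute measurements: $(O,k)\in\mathcal E_{\rm a}$ means agent $k$ measures its absolute position in the form $p_{kO}=-p_k$. $\mathrm G_{\rm o}^+=(\mathcal V\cup\{O\},\mathcal E_{\rm o}\cup\mathcal E_{\rm a})$. A source is a node of in-degree $0$. The output $y_i$ stacks all relative and absolute measurements of agent $i$; thus each measurement of agent $i$ contributes a $2\times 2$ block $-I_2$ to $C_{ii}$, and if agent $i$ has no measurement then $C_{ii}$ is a zero matrix. *)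

theory Defs
  imports
    Complex_Main
    "Jordan_Normal_Form.Matrix"
    "Graph_Theory.Pair_Digraph"
begin

(* Solutions on [0,T] of the unforced system x' = A x, with the derivative taken componentwise
   because real vec is not a normed space. *)
definition lti_trajectory :: "real mat \<Rightarrow> real \<Rightarrow> (real \<Rightarrow> real vec) \<Rightarrow> bool" where
  "lti_trajectory A T x \<longleftrightarrow>
     (\<forall>t\<in>{0..T}. x t \<in> carrier_vec (dim_row A) \<and>
        (\<forall>k<dim_row A. ((\<lambda>s. x s $ k) has_real_derivative (A *\<^sub>v x t) $ k) (at t within {0..T})))"

(* For a linear system a known input changes nothing: the forced response cancels when two outputs
   are compared. *)
definition observable :: "real mat \<Rightarrow> real mat \<Rightarrow> bool" where
  "observable A C \<longleftrightarrow>
     (\<exists>T>0. \<forall>x x'. lti_trajectory A T x \<longrightarrow> lti_trajectory A T x' \<longrightarrow>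
        (\<forall>t\<in>{0..T}. C *\<^sub>v x t = C *\<^sub>v x' t) \<longrightarrow> x 0 = x' 0)"

datatype node = Origin | Agent nat

definition neighbours :: "nat pair_pre_digraph \<Rightarrow> nat \<Rightarrow> nat set" where
  "neighbours G i = {j. j \<noteq> i \<and> (j, i) \<in> parcs G}"

definition augmented_graph :: "nat pair_pre_digraph \<Rightarrow> node rel \<Rightarrow> node pair_pre_digraph" where
  "augmented_graph G E\<^sub>a =
     \<lparr> pverts = insert Origin (Agent ` pverts G),
       parcs = map_prod Agent Agent ` parcs G \<union> E\<^sub>a \<rparr>"

definition is_source :: "'a pair_pre_digraph \<Rightarrow> 'a \<Rightarrow> bool" where
  "is_source G v \<longleftrightarrow> v \<in> pverts G \<and> in_degree (with_proj G) v = 0"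

(* What agent i reads off along the arc from v to Agent i, for agents at positions p:
   p_j - p_i if v = Agent j, and 0 - p_i if v = Origin. *)
fun measurement :: "(nat \<Rightarrow> real vec) \<Rightarrow> nat \<Rightarrow> node \<Rightarrow> real vec" where
  "measurement p i (Agent j) = p j - p i"
| "measurement p i Origin = - p i"

(* The output of agent i, whose measurements are stacked in the order given by ms. *)
definition stacked_output :: "(nat \<Rightarrow> real vec) \<Rightarrow> nat \<Rightarrow> node list \<Rightarrow> real vec" where
  "stacked_output p i ms = foldr (\<lambda>v y. measurement p i v @\<^sub>v y) ms (0\<^sub>v 0)"

end

theory Submission
  imports Defs
begin

(* With zero dynamics the state is constant, so observability of (0, C_ii) is injectivity of C_ii.
   Placing every agent except i at the origin makes the output of agent i equal to C_ii p_i, while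
   each of its measurements then reads - p_i, because no measurement of i is taken from i itself.
   So a single measurement already gives injectivity, and without any C_ii = 0 is not injective. *)

text \<open>Serves to drop the neighbour terms from the output when all neighbours sit at the
  origin.\<close>

lemma finsum_vec_zero:
  assumes "\<And>j. j \<in> S \<Longrightarrow> f j = 0\<^sub>v n"
  shows "finsum_vec TYPE('a::comm_monoid_add) n f S = 0\<^sub>v n"
  using assms
  by (rule comm_monoid.finprod_one_eqI[OF comm_monoid_vec, folded finsum_vec_def, unfolded monoid_vec_simps])

lemma stacked_output_Cons:
  "stacked_output p i (v # vs) = measurement p i v @\<^sub>v stacked_output p i vs"
  by (simp add: stacked_output_def)

text \<open>\<open>Agent i\<close> has to be excluded: measured from itself, agent i would read x -
  x = 0 and reveal nothing about x.\<close>

lemma measurement_single_agent: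
  assumes "x \<in> carrier_vec n" and "v \<noteq> Agent i"
  shows "measurement (\<lambda>j. if j = i then x else 0\<^sub>v n) i v = - x"
  using assms by (cases v) auto

lemma lti_trajectory_const:
  assumes "x \<in> carrier_vec n"
  shows "lti_trajectory (0\<^sub>m n n) T (\<lambda>_. x)"
  using assms by (auto simp: lti_trajectory_def)

text \<open>Comparing the outputs at time 0 alone already separates the initial states, so any
  positive horizon serves as witness; 1 is an arbitrary choice.\<close>

lemma observable_zero_dynamicsI:
  assumes "\<And>x x'. x \<in> carrier_vec n \<Longrightarrow> x' \<in> carrier_vec n \<Longrightarrow> C *\<^sub>v x = C *\<^sub>v x' \<Longrightarrow> x = x'"
  shows "observable (0\<^sub>m n n) C"
  unfolding observable_def
proof (intro exI[of _ 1] conjI allI impI)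
  fix x x' :: "real \<Rightarrow> real vec"
  assume "lti_trajectory (0\<^sub>m n n) 1 x" "lti_trajectory (0\<^sub>m n n) 1 x'"
    "\<forall>t\<in>{0..1}. C *\<^sub>v x t = C *\<^sub>v x' t"
  then show "x 0 = x' 0"
    using assms by (force simp: lti_trajectory_def)
qed simp

text \<open>Whatever the horizon, the constant trajectories at a unit vector and at 0 are both
  mapped to the zero output; n > 0 makes their entries at index 0 exist and differ.\<close>

lemma not_observable_zero_output:
  assumes "n > 0"
  shows "\<not> observable (0\<^sub>m n n) (0\<^sub>m k n)"
proof
  let ?e = "unit_vec n 0 :: real vec"
  assume "observable (0\<^sub>m n n) (0\<^sub>m k n)"
  then obtain T where "\<And>x x'. lti_trajectory (0\<^sub>m n n) T x \<Longrightarrow> lti_trajectory (0\<^sub>m n n) T x' \<Longrightarrow>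
      (\<forall>t\<in>{0..T}. 0\<^sub>m k n *\<^sub>v x t = 0\<^sub>m k n *\<^sub>v x' t) \<Longrightarrow> x 0 = x' 0"
    unfolding observable_def by blast
  note this[of "\<lambda>_. ?e" "\<lambda>_. 0\<^sub>v n"]
  moreover have "0\<^sub>m k n *\<^sub>v ?e = 0\<^sub>m k n *\<^sub>v 0\<^sub>v n" by auto
  ultimately have "?e = 0\<^sub>v n"
    by (auto simp: lti_trajectory_const)
  then have "?e $ 0 = 0\<^sub>v n $ 0" by simp
  with assms show False by simp
qed

text \<open>Finiteness matters because \<open>in_degree\<close> is a cardinality, which would also
  be 0 for an infinite set of incoming arcs.\<close>

lemma is_source_iff:
  assumes "finite (parcs G)" and "v \<in> pverts G"
  shows "is_source G v \<longleftrightarrow> {u. (u, v) \<in> parcs G} = {}"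
proof -
  have "finite (in_arcs (with_proj G) v)"
    using assms(1) by (auto simp: in_arcs_def)
  then show ?thesis
    using assms(2) by (auto simp: is_source_def in_degree_def in_arcs_def)
qed

theorem proposition2:
  fixes m :: nat
    and G\<^sub>o :: "nat pair_pre_digraph"
    and E\<^sub>a :: "node rel"
    and ms :: "nat \<Rightarrow> node list"
    and q :: "nat \<Rightarrow> nat"
    and C :: "nat \<Rightarrow> nat \<Rightarrow> real mat"
  assumes "pair_digraph G\<^sub>o"
    and "pverts G\<^sub>o = {1..m}"
    and "E\<^sub>a \<subseteq> {Origin} \<times> Agent ` {1..m}"
    and "\<And>i. i \<in> {1..m} \<Longrightarrow> distinct (ms i)"
    and "\<And>i. i \<in> {1..m} \<Longrightarrow> set (ms i) = {v. (v, Agent i) \<in> parcs (augmented_graph G\<^sub>o E\<^sub>a)}"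
    and "\<And>i j. i \<in> {1..m} \<Longrightarrow> j \<in> insert i (neighbours G\<^sub>o i) \<Longrightarrow> C i j \<in> carrier_mat (q i) 2"
    and "\<And>i p. i \<in> {1..m} \<Longrightarrow> ms i \<noteq> [] \<Longrightarrow> (\<And>j. j \<in> {1..m} \<Longrightarrow> p j \<in> carrier_vec 2) \<Longrightarrow>
           stacked_output p i (ms i) =
             C i i *\<^sub>v p i + finsum_vec TYPE(real) (q i) (\<lambda>j. C i j *\<^sub>v p j) (neighbours G\<^sub>o i)"
    and "\<And>i. i \<in> {1..m} \<Longrightarrow> ms i = [] \<Longrightarrow> C i i = 0\<^sub>m (q i) 2"
  shows "\<forall>i\<in>{1..m}.
           (observable (0\<^sub>m 2 2) (C i i) \<longleftrightarrow> \<not> is_source (augmented_graph G\<^sub>o E\<^sub>a) (Agent i)) \<and>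
           (\<not> is_source (augmented_graph G\<^sub>o E\<^sub>a) (Agent i) \<longleftrightarrow>
              neighbours G\<^sub>o i \<noteq> {} \<or> (Origin, Agent i) \<in> E\<^sub>a)"
proof
  fix i assume i: "i \<in> {1..m}"
  let ?G = "augmented_graph G\<^sub>o E\<^sub>a"
  interpret pair_digraph G\<^sub>o by fact
  have "finite E\<^sub>a" using assms(3) by (rule finite_subset) auto
  then have "finite (parcs ?G)"
    by (simp add: augmented_graph_def)
  moreover have "Agent i \<in> pverts ?G"
    using i assms(2) by (simp add: augmented_graph_def)
  ultimately have source: "is_source ?G (Agent i) \<longleftrightarrow> set (ms i) = {}"
    using assms(5)[OF i] is_source_iff by metis
  \<comment> \<open>Serves twice: each arc of \<open>G\<^sub>o\<close> into i starts at a neighbour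
    of i, and the measurement picked below is not taken from i itself.\<close>
  have no_loop: "(j, j) \<notin> parcs G\<^sub>o" for j
    using no_loops by fastforce
  have ms: "set (ms i) = Agent ` neighbours G\<^sub>o i \<union> (if (Origin, Agent i) \<in> E\<^sub>a then {Origin} else {})"
    unfolding assms(5)[OF i] using assms(3) no_loop
    by (auto simp: augmented_graph_def neighbours_def)
  have "observable (0\<^sub>m 2 2) (C i i)" if ne: "ms i \<noteq> []"
  proof (rule observable_zero_dynamicsI)
    fix x x' :: "real vec"
    assume x: "x \<in> carrier_vec 2" and x': "x' \<in> carrier_vec 2"
      and eq: "C i i *\<^sub>v x = C i i *\<^sub>v x'"
    define p :: "real vec \<Rightarrow> nat \<Rightarrow> real vec" where "p y = (\<lambda>j. if j = i then y else 0\<^sub>v 2)" for y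
    have out: "stacked_output (p y) i (ms i) = C i i *\<^sub>v y" if y: "y \<in> carrier_vec 2" for y
    proof -
      \<comment> \<open>A neighbour differs from i, so it sits at the origin; its block has
        \<open>q i\<close> rows, which fixes the dimension of the zero vector.\<close>
      have "C i j *\<^sub>v p y j = 0\<^sub>v (q i)" if "j \<in> neighbours G\<^sub>o i" for j
        using that assms(6)[OF i, of j] by (auto simp: neighbours_def p_def)
      then show ?thesis
        using assms(7)[OF i ne, of "p y"] assms(6)[OF i, of i] y
        by (simp add: finsum_vec_zero p_def)
    qed
    \<comment> \<open>The first measurement is the leading block of the stacked output, so it can be
      split off without knowing the rest.\<close>
    obtain v vs where v: "ms i = v # vs" using ne by (cases "ms i") auto
    then have "v \<noteq> Agent i"
      using assms(5)[OF i] no_loop assms(3) by (auto simp: augmented_graph_def)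
    then have meas: "measurement (p y) i v = - y" if "y \<in> carrier_vec 2" for y
      using that by (simp add: p_def measurement_single_agent)
    have "- x @\<^sub>v stacked_output (p x) i vs = - x' @\<^sub>v stacked_output (p x') i vs"
      using out[OF x] out[OF x'] eq by (simp add: v stacked_output_Cons meas x x')
    \<comment> \<open>Both leading blocks have length 2, so equality of the stacks gives equality of
      these blocks.\<close>
    then have "- x = - x'"
      using x x' append_vec_eq[of "- x" 2 "- x'"] by simp
    then show "x = x'" by simp
  qed
  \<comment> \<open>The converse is the case of an empty list, where \<open>C i i\<close> is a zero
    matrix with two columns and \<open>q i\<close> rows, for any value of
    \<open>q i\<close>.\<close>
  then have "observable (0\<^sub>m 2 2) (C i i) \<longleftrightarrow> ms i \<noteq> []"
    using assms(8)[OF i] not_observable_zero_output[of 2 "q i"] by auto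
  then show "(observable (0\<^sub>m 2 2) (C i i) \<longleftrightarrow> \<not> is_source ?G (Agent i)) \<and>
      (\<not> is_source ?G (Agent i) \<longleftrightarrow> neighbours G\<^sub>o i \<noteq> {} \<or> (Origin, Agent i) \<in> E\<^sub>a)"
    using source ms by auto
qed

end
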